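(* Let $k\ge 2$ be fixed. There is an $O(n^{k})$-time algorithm which, given a graph $G$ with $n$ vertices and $\alpha(G)=k$ and a vertex $v\in V(G)$, decides whether $v$ is shedding.
   Context: Graphs are finite, simple, undirected. $N(v)$ is the neighbourhood of $v$, $N[v]=N(v)\cup\{v\}$. A set is independent if its vertices are pairwise nonadjacent; $\alpha(G)$ is the maximum size of an independent set. A vertex $v$ is shedding if for every independent set $S\subseteq V(G)\setminus N[v]$ there exists $u\in N(v)$ such that $S\cup\{u\}$ is independent. *)

theory Defs
  imports
    "Graph_Theory.Pair_Digraph"
    "HOL-Library.Landau_Symbols"
    "HOL-Library.Log_Nat"
begin

text \<open>
  Finite simple undirected graphs are taken from the library: \<open>pair_graph G\<close> says that
  \<open>G\<close> is finite, loop-free and symmetric, so that an edge \<open>uv\<close> is the pair of arcs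
  \<open>(u, v)\<close> and \<open>(v, u)\<close> in \<open>parcs G\<close>.
\<close>

definition neighbourhood :: "'a pair_pre_digraph \<Rightarrow> 'a \<Rightarrow> 'a set" where
  "neighbourhood G v = {u \<in> pverts G. (v, u) \<in> parcs G}"

definition closed_neighbourhood :: "'a pair_pre_digraph \<Rightarrow> 'a \<Rightarrow> 'a set" where
  "closed_neighbourhood G v = neighbourhood G v \<union> {v}"

definition independent_set :: "'a pair_pre_digraph \<Rightarrow> 'a set \<Rightarrow> bool" where
  "independent_set G S \<longleftrightarrow> S \<subseteq> pverts G \<and> (\<forall>x\<in>S. \<forall>y\<in>S. (x, y) \<notin> parcs G)"

definition independence_number :: "'a pair_pre_digraph \<Rightarrow> nat" where
  "independence_number G = Max {card S | S. independent_set G S}"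

definition shedding_vertex :: "'a pair_pre_digraph \<Rightarrow> 'a \<Rightarrow> bool" where
  "shedding_vertex G v \<longleftrightarrow>
    (\<forall>S. S \<subseteq> pverts G - closed_neighbourhood G v \<and> independent_set G S \<longrightarrow>
      (\<exists>u\<in>neighbourhood G v. independent_set G (S \<union> {u})))"

text \<open>
  The machine model is the word RAM: a program is a fixed list of instructions acting on
  registers and on a random access memory. Every value that an instruction computes is a word of
  \<open>w\<close> bits, where \<open>w\<close> is logarithmic in the number of vertices, and every instruction costs one
  time unit. The bounded word size makes the uniform cost measure meaningful, since a single
  instruction cannot operate on very long numbers.

  A program mentions registers only by constant indices; only \<open>Load\<close> and \<open>Store\<close> use a computed
  address. The second argument of \<open>JumpPos\<close> is a position in the program.
\<close>

datatype instr =
    Const nat nat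
  | Add nat nat nat
  | Sub nat nat nat
  | Load nat nat
  | Store nat nat
  | JumpPos nat nat

type_synonym program = "instr list"

record config =
  pc :: nat
  reg :: "nat \<Rightarrow> nat"
  mem :: "nat \<Rightarrow> nat"

text \<open>
  \<open>Add\<close> and \<open>Const\<close> work modulo \<open>2 ^ w\<close>. \<open>Sub\<close> is cut off at \<open>0\<close>, which together with
  \<open>JumpPos\<close> provides comparison of words.
\<close>

fun exec_instr :: "nat \<Rightarrow> instr \<Rightarrow> config \<Rightarrow> config" where
  "exec_instr w (Const d c) s =
    s\<lparr>pc := Suc (pc s), reg := (reg s)(d := c mod 2 ^ w)\<rparr>"
| "exec_instr w (Add d a b) s =
    s\<lparr>pc := Suc (pc s), reg := (reg s)(d := (reg s a + reg s b) mod 2 ^ w)\<rparr>"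
| "exec_instr w (Sub d a b) s =
    s\<lparr>pc := Suc (pc s), reg := (reg s)(d := reg s a - reg s b)\<rparr>"
| "exec_instr w (Load d a) s =
    s\<lparr>pc := Suc (pc s), reg := (reg s)(d := mem s (reg s a))\<rparr>"
| "exec_instr w (Store a b) s =
    s\<lparr>pc := Suc (pc s), mem := (mem s)(reg s a := reg s b)\<rparr>"
| "exec_instr w (JumpPos a l) s =
    s\<lparr>pc := (if reg s a > 0 then l else Suc (pc s))\<rparr>"

definition halted :: "program \<Rightarrow> config \<Rightarrow> bool" where
  "halted P s \<longleftrightarrow> length P \<le> pc s"

definition step :: "nat \<Rightarrow> program \<Rightarrow> config \<Rightarrow> config" where
  "step w P s = (if halted P s then s else exec_instr w (P ! pc s) s)"

text \<open>
  Started in \<open>s\<close>, the program halts after at most \<open>t\<close> steps, with answer \<open>1\<close> in register \<open>0\<close>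
  if \<open>b\<close> holds and answer \<open>0\<close> otherwise.
\<close>

definition decides_within :: "nat \<Rightarrow> program \<Rightarrow> config \<Rightarrow> nat \<Rightarrow> bool \<Rightarrow> bool" where
  "decides_within w P s t b \<longleftrightarrow>
    (\<exists>t'\<le>t. halted P ((step w P ^^ t') s) \<and> reg ((step w P ^^ t') s) 0 = of_bool b)"

text \<open>
  The input is a graph on the vertices \<open>0, \<dots>, n - 1\<close> and a vertex \<open>v\<close>: the registers \<open>0\<close> and
  \<open>1\<close> hold \<open>n\<close> and \<open>v\<close>, and the memory holds the adjacency matrix row by row, starting at
  address \<open>0\<close>. All other registers and memory cells are \<open>0\<close>.
\<close>

definition input_config :: "nat \<Rightarrow> nat pair_pre_digraph \<Rightarrow> nat \<Rightarrow> config" where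
  "input_config n G v =
    \<lparr>pc = 0,
     reg = (\<lambda>_. 0)(0 := n, 1 := v),
     mem = (\<lambda>a. if a < n * n \<and> (a div n, a mod n) \<in> parcs G then 1 else 0)\<rparr>"

text \<open>
  For \<open>n \<ge> 1\<close>, \<open>floorlog 2 n\<close> is the length of the binary representation of \<open>n\<close>. For
  \<open>c \<ge> 1\<close>, the whole input therefore consists of words.
\<close>

definition word_size :: "nat \<Rightarrow> nat \<Rightarrow> nat" where
  "word_size c n = c * floorlog 2 n"

end

theory Submission
  imports Defs
begin

text \<open>
  If \<open>\<alpha>(G) = k\<close> and \<open>S\<close> is an independent set that avoids \<open>N[v]\<close>, then \<open>S \<union> {v}\<close> is
  independent, so \<open>S\<close> has at most \<open>k - 1\<close> elements. It therefore suffices to run through the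
  \<open>(k - 1)\<close>-tuples of vertices and to test for each of them, in time \<open>O(n)\<close>, whether its entries
  form such a set and dominate \<open>N(v)\<close>. Tuples miss the empty set, but if the empty set is a
  witness against shedding, then \<open>v\<close> is isolated and every singleton avoiding \<open>v\<close> is one too.

  The program contains no data dependent branch: truth values are words \<open>0\<close> and \<open>1\<close>, and a flag is
  cleared by a truncated subtraction. Its running time is then a function of \<open>n\<close> alone.
\<close>

section \<open>Counting loops on the word RAM\<close>

datatype com = Block "instr list" | Seq com com | Repeat nat com

text \<open>
  In \<open>Repeat r c\<close> the counter \<open>r\<close> runs from \<open>0\<close> to \<open>n - 1\<close>. Register \<open>0\<close> holds \<open>n\<close>, register
  \<open>2\<close> holds \<open>1\<close>, and register \<open>3\<close> receives the loop condition.
\<close>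

fun compile :: "nat \<Rightarrow> com \<Rightarrow> program" where
  "compile b (Block is) = is"
| "compile b (Seq c1 c2) = compile b c1 @ compile (b + length (compile b c1)) c2"
| "compile b (Repeat r c) =
    Const r 0 # compile (Suc b) c @ [Add r r 2, Sub 3 0 r, JumpPos 3 (Suc b)]"

fun dur :: "nat \<Rightarrow> com \<Rightarrow> nat" where
  "dur n (Block is) = length is"
| "dur n (Seq c1 c2) = dur n c1 + dur n c2"
| "dur n (Repeat r c) = Suc (n * (dur n c + 3))"

text \<open>Commands neither store nor jump on their own, so the memory \<open>M\<close> is a fixed
  parameter and only the registers evolve. The last equation is a default for instructions that
  \<open>wf_com\<close> rules out.\<close>

fun alu :: "nat \<Rightarrow> (nat \<Rightarrow> nat) \<Rightarrow> instr \<Rightarrow> (nat \<Rightarrow> nat) \<Rightarrow> nat \<Rightarrow> nat" where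
  "alu w M (Const d c) \<rho> = \<rho>(d := c mod 2 ^ w)"
| "alu w M (Add d a b) \<rho> = \<rho>(d := (\<rho> a + \<rho> b) mod 2 ^ w)"
| "alu w M (Sub d a b) \<rho> = \<rho>(d := \<rho> a - \<rho> b)"
| "alu w M (Load d a) \<rho> = \<rho>(d := M (\<rho> a))"
| "alu w M _ \<rho> = \<rho>"

fun run :: "nat \<Rightarrow> nat \<Rightarrow> (nat \<Rightarrow> nat) \<Rightarrow> com \<Rightarrow> (nat \<Rightarrow> nat) \<Rightarrow> nat \<Rightarrow> nat" where
  "run w n M (Block is) \<rho> = fold (alu w M) is \<rho>"
| "run w n M (Seq c1 c2) \<rho> = run w n M c2 (run w n M c1 \<rho>)"
| "run w n M (Repeat r c) \<rho> =
    ((\<lambda>\<rho>. fold (alu w M) [Add r r 2, Sub 3 0 r] (run w n M c \<rho>)) ^^ n) (\<rho>(r := 0))"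

fun dests :: "instr \<Rightarrow> nat set" where
  "dests (Const d c) = {d}"
| "dests (Add d a b) = {d}"
| "dests (Sub d a b) = {d}"
| "dests (Load d a) = {d}"
| "dests _ = {}"

fun writes :: "com \<Rightarrow> nat set" where
  "writes (Block is) = \<Union> (dests ` set is)"
| "writes (Seq c1 c2) = writes c1 \<union> writes c2"
| "writes (Repeat r c) = insert r (insert 3 (writes c))"

text \<open>A nonempty \<open>dests\<close> excludes exactly \<open>Store\<close> and
  \<open>JumpPos\<close>. Protecting the counter from the body and from the condition register 3
  fixes the number of passes.\<close>

fun wf_com :: "com \<Rightarrow> bool" where
  "wf_com (Block is) \<longleftrightarrow> (\<forall>i\<in>set is. dests i \<noteq> {})"
| "wf_com (Seq c1 c2) \<longleftrightarrow> wf_com c1 \<and> wf_com c2"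
| "wf_com (Repeat r c) \<longleftrightarrow> wf_com c \<and> r \<noteq> 3 \<and> r \<notin> writes c"

section \<open>Simulation of commands by compiled code\<close>

lemma alu_other: "r \<notin> dests i \<Longrightarrow> alu w M i \<rho> r = \<rho> r"
  by (cases i) auto

lemma fold_alu_other: "r \<notin> \<Union> (dests ` set is) \<Longrightarrow> fold (alu w M) is \<rho> r = \<rho> r"
  by (induction "is" arbitrary: \<rho>) (auto simp: alu_other)

lemma run_other: "r \<notin> writes c \<Longrightarrow> run w n M c \<rho> r = \<rho> r"
proof (induction c arbitrary: \<rho>)
  case (Block "is")
  then show ?case by (simp add: fold_alu_other)
next
  case (Seq c1 c2)
  then show ?case by simp
next
  case (Repeat q c)
  define g where "g = (\<lambda>\<rho>. fold (alu w M) [Add q q 2, Sub 3 0 q] (run w n M c \<rho>))"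
  have "(g ^^ j) \<rho>' r = \<rho>' r" for j \<rho>'
    using Repeat by (induction j) (simp_all add: g_def)
  then show ?case
    using Repeat.prems unfolding run.simps g_def[symmetric] by simp
qed

abbreviation cfg :: "(nat \<Rightarrow> nat) \<Rightarrow> nat \<Rightarrow> (nat \<Rightarrow> nat) \<Rightarrow> config" where
  "cfg M p \<rho> \<equiv> \<lparr>pc = p, reg = \<rho>, mem = M\<rparr>"

lemma step_at:
  "P = pre @ i # post \<Longrightarrow> p = length pre \<Longrightarrow> step w P (cfg M p \<rho>) = exec_instr w i (cfg M p \<rho>)"
  by (simp add: step_def halted_def)

lemma exec_instr_alu: "dests i \<noteq> {} \<Longrightarrow> exec_instr w i (cfg M p \<rho>) = cfg M (Suc p) (alu w M i \<rho>)"
  by (cases i) auto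

lemma funpow_trans: "(f ^^ s) x = y \<Longrightarrow> (f ^^ t) y = z \<Longrightarrow> (f ^^ (s + t)) x = z"
  by (metis add.commute comp_apply funpow_add)

lemma steps_block:
  "\<forall>i\<in>set is. dests i \<noteq> {} \<Longrightarrow> P = pre @ is @ post \<Longrightarrow>
    (step w P ^^ length is) (cfg M (length pre) \<rho>) =
      cfg M (length pre + length is) (fold (alu w M) is \<rho>)"
proof (induction "is" arbitrary: pre \<rho>)
  case Nil
  then show ?case by simp
next
  case (Cons i "is")
  have "(step w P ^^ 1) (cfg M (length pre) \<rho>) = cfg M (length (pre @ [i])) (alu w M i \<rho>)"
    using Cons.prems step_at[of P pre i "is @ post"] by (simp add: exec_instr_alu)
  from funpow_trans[OF this Cons.IH] Cons.prems show ?case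
    by simp
qed

text \<open>Jump targets are absolute, hence the arbitrary prefix \<open>pre\<close>. A compiled
  loop tests its condition only after the body, so \<open>n \<ge> 1\<close> is what makes
  \<open>n\<close> passes correct; \<open>n < 2 ^ w\<close> lets the counter reach \<open>n\<close>
  without wrapping.\<close>

lemma compile_correct:
  assumes "wf_com c" "0 \<notin> writes c" "2 \<notin> writes c" "\<rho> 0 = n" "\<rho> 2 = 1" "n \<ge> 1" "n < 2 ^ w"
    and "P = pre @ compile (length pre) c @ post"
  shows "(step w P ^^ dur n c) (cfg M (length pre) \<rho>) =
    cfg M (length pre + length (compile (length pre) c)) (run w n M c \<rho>)"
  using assms
proof (induction c arbitrary: pre post \<rho>)
  case (Block "is")
  then show ?case using steps_block[of "is" P pre post w] by simp
next
  case (Seq c1 c2)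
  let ?pre = "pre @ compile (length pre) c1"
  have "(step w P ^^ dur n c1) (cfg M (length pre) \<rho>) = cfg M (length ?pre) (run w n M c1 \<rho>)"
    using Seq.prems Seq.IH(1)[of \<rho> pre "compile (length ?pre) c2 @ post"] by simp
  moreover have "(step w P ^^ dur n c2) (cfg M (length ?pre) (run w n M c1 \<rho>)) =
      cfg M (length ?pre + length (compile (length ?pre) c2)) (run w n M c2 (run w n M c1 \<rho>))"
    using Seq.prems by (intro Seq.IH(2)[of _ _ post]) (simp_all add: run_other)
  ultimately show ?case
    by (simp add: funpow_trans add.assoc)
next
  case (Repeat r c)
  define g where "g = (\<lambda>\<rho>. fold (alu w M) [Add r r 2, Sub 3 0 r] (run w n M c \<rho>))"
  let ?pre = "pre @ [Const r 0]"
  let ?code = "compile (Suc (length pre)) c"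
  have P: "P = ?pre @ compile (length ?pre) c @
      [Add r r 2, Sub 3 0 r, JumpPos 3 (length ?pre)] @ post"
    using Repeat.prems by simp
  have r: "r \<noteq> 0" "r \<noteq> 2" "r \<noteq> 3" "r \<notin> writes c"
    using Repeat.prems by auto
  \<comment> \<open>One pass including the jump: register 3 ends up as \<open>n - Suc j\<close>,
    which is positive exactly when another pass is due.\<close>
  have body: "(step w P ^^ (dur n c + 3)) (cfg M (length ?pre) \<rho>') =
      cfg M (if Suc j < n then length ?pre else length ?pre + length ?code + 3) (g \<rho>') \<and>
      g \<rho>' 0 = n \<and> g \<rho>' 2 = 1 \<and> g \<rho>' r = Suc j"
    if "\<rho>' 0 = n" "\<rho>' 2 = 1" "\<rho>' r = j" "j < n" for \<rho>' j
  proof -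
    let ?\<rho> = "run w n M c \<rho>'" and ?pre2 = "?pre @ ?code"
    have vals: "g \<rho>' 0 = n" "g \<rho>' 2 = 1" "g \<rho>' r = Suc j" "g \<rho>' 3 = n - Suc j"
      using that r Repeat.prems by (auto simp: g_def run_other)
    have "(step w P ^^ dur n c) (cfg M (length ?pre) \<rho>') = cfg M (length ?pre2) ?\<rho>"
      using Repeat.prems that P Repeat.IH[of \<rho>' ?pre] by simp
    moreover have "(step w P ^^ 2) (cfg M (length ?pre2) ?\<rho>) = cfg M (length ?pre2 + 2) (g \<rho>')"
      using P steps_block[of "[Add r r 2, Sub 3 0 r]" P ?pre2 "JumpPos 3 (length ?pre) # post" w]
      by (simp add: g_def numeral_2_eq_2)
    moreover have "(step w P ^^ 1) (cfg M (length ?pre2 + 2) (g \<rho>')) =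
        cfg M (if Suc j < n then length ?pre else length ?pre + length ?code + 3) (g \<rho>')"
      using P vals step_at[of P "?pre2 @ [Add r r 2, Sub 3 0 r]" "JumpPos 3 (length ?pre)" post]
      by simp
    ultimately have "(step w P ^^ (dur n c + (2 + 1))) (cfg M (length ?pre) \<rho>') =
        cfg M (if Suc j < n then length ?pre else length ?pre + length ?code + 3) (g \<rho>')"
      by (intro funpow_trans)
    then show ?thesis using vals by simp
  qed
  define \<rho>0 where "\<rho>0 = \<rho>(r := 0)"
  \<comment> \<open>After fewer than \<open>n\<close> passes control is back at the start of the
    body; after the last pass it is behind the jump.\<close>
  have loop: "(step w P ^^ (j * (dur n c + 3))) (cfg M (length ?pre) \<rho>0) =
      cfg M (if j < n then length ?pre else length ?pre + length ?code + 3) ((g ^^ j) \<rho>0) \<and>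
      (g ^^ j) \<rho>0 0 = n \<and> (g ^^ j) \<rho>0 2 = 1 \<and> (g ^^ j) \<rho>0 r = j" if "j \<le> n" for j
    using that
  proof (induction j)
    case 0
    then show ?case using Repeat.prems r by (simp add: \<rho>0_def)
  next
    case (Suc j)
    then have IH: "(step w P ^^ (j * (dur n c + 3))) (cfg M (length ?pre) \<rho>0) =
        cfg M (length ?pre) ((g ^^ j) \<rho>0)"
      and b: "(g ^^ j) \<rho>0 0 = n" "(g ^^ j) \<rho>0 2 = 1" "(g ^^ j) \<rho>0 r = j"
      by simp_all
    have bd: "(step w P ^^ (dur n c + 3)) (cfg M (length ?pre) ((g ^^ j) \<rho>0)) =
      cfg M (if Suc j < n then length ?pre else length ?pre + length ?code + 3) (g ((g ^^ j) \<rho>0)) \<and>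
      g ((g ^^ j) \<rho>0) 0 = n \<and> g ((g ^^ j) \<rho>0) 2 = 1 \<and> g ((g ^^ j) \<rho>0) r = Suc j"
      using Suc.prems by (intro body b) simp
    have "Suc j * (dur n c + 3) = j * (dur n c + 3) + (dur n c + 3)"
      by simp
    then show ?case
      using bd funpow_trans[OF IH bd[THEN conjunct1]] by (simp only: funpow.simps comp_apply)
  qed
  have "(step w P ^^ 1) (cfg M (length pre) \<rho>) = cfg M (length ?pre) \<rho>0"
    using P step_at[of P pre "Const r 0"] by (simp add: \<rho>0_def)
  from funpow_trans[OF this loop[THEN conjunct1, OF order_refl]]
  show ?case unfolding run.simps g_def[symmetric] \<rho>0_def by simp
qed


section \<open>Nested loops over vertices\<close>

text \<open>
  The loop variable with index \<open>i\<close> is kept in register \<open>idx i\<close>. As there is no multiplication,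
  the offset of its row in the adjacency matrix is maintained in register \<open>row i\<close>. There is
  no such offset for \<open>v\<close>, so adjacency to \<open>v\<close> is always read from column \<open>v\<close>.
\<close>

definition idx :: "nat \<Rightarrow> nat" where "idx i = 8 + 2 * i"
definition row :: "nat \<Rightarrow> nat" where "row i = 9 + 2 * i"

lemma idx_row_simps [simp]:
  "idx i = idx j \<longleftrightarrow> i = j" "row i = row j \<longleftrightarrow> i = j" "idx i \<noteq> row j" "row i \<noteq> idx j"
  by (auto simp: idx_def row_def) presburger+

lemma idx_row_ge [simp]:
  "a < 8 \<Longrightarrow> idx i \<noteq> a" "a < 8 \<Longrightarrow> a \<noteq> idx i" "a < 8 \<Longrightarrow> row i \<noteq> a" "a < 8 \<Longrightarrow> a \<noteq> row i"
  by (auto simp: idx_def row_def)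

definition vertex_loop :: "nat \<Rightarrow> com \<Rightarrow> com" where
  "vertex_loop i c =
    Seq (Block [Const (row i) 0]) (Repeat (idx i) (Seq c (Block [Add (row i) (row i) 0])))"

text \<open>The outermost loop carries the largest index, so the loops of \<open>nest c m\<close>
  that enclose \<open>nest c i\<close> are those with indices from \<open>i\<close> to
  \<open>m - 1\<close>.\<close>

fun nest :: "com \<Rightarrow> nat \<Rightarrow> com" where
  "nest c 0 = c"
| "nest c (Suc i) = vertex_loop i (nest c i)"

text \<open>In a pair, \<open>r\<close> names a register with a row offset and \<open>x\<close> one
  with a column, so their contents add up to the address of a matrix entry.\<close>

definition clear_adjacent :: "nat \<Rightarrow> (nat \<times> nat) list \<Rightarrow> instr list" where
  "clear_adjacent a ps = concat (map (\<lambda>(r, x). [Add 4 r x, Load 4 4, Sub a a 4]) ps)"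

text \<open>
  The test for \<open>x = v\<close> is that \<open>1 - (x - v) - (v - x)\<close>, with truncated subtractions, is \<open>1\<close>.
\<close>

definition clear_equal :: "nat \<Rightarrow> nat list \<Rightarrow> instr list" where
  "clear_equal a xs =
    concat (map (\<lambda>x. [Sub 4 x 1, Sub 4 2 4, Sub 3 1 x, Sub 4 4 3, Sub a a 4]) xs)"

text \<open>
  Register \<open>1\<close> holds \<open>v\<close>, \<open>3\<close> and \<open>4\<close> are scratch space, \<open>5\<close> says that the current tuple is an
  independent set avoiding \<open>N[v]\<close> that dominates all neighbours of \<open>v\<close> seen so far, \<open>6\<close> says that
  the vertex \<open>idx m\<close> is an undominated neighbour of \<open>v\<close>, and \<open>7\<close> is the answer.
\<close>

definition check_tuple :: "nat \<Rightarrow> instr list" where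
  "check_tuple m = Const 5 1 #
    clear_adjacent 5 (map (\<lambda>i. (row i, 1)) [0..<m] @
      concat (map (\<lambda>i. map (\<lambda>j. (row i, idx j)) [0..<m]) [0..<m])) @
    clear_equal 5 (map idx [0..<m])"

definition check_dominated :: "nat \<Rightarrow> instr list" where
  "check_dominated m = [Add 4 (row m) 1, Load 6 4] @
    clear_adjacent 6 (map (\<lambda>i. (row i, idx m)) [0..<m]) @ [Sub 5 5 6]"

definition tuple_test :: "nat \<Rightarrow> com" where
  "tuple_test m = Seq (Block (check_tuple m))
    (Seq (vertex_loop m (Block (check_dominated m))) (Block [Sub 7 7 5]))"

definition shedding_com :: "nat \<Rightarrow> com" where
  "shedding_com m = Seq (Block [Const 7 1]) (nest (tuple_test m) m)"

definition shedding_program :: "nat \<Rightarrow> program" where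
  "shedding_program m = Const 2 1 # compile 1 (shedding_com m) @ [Const 0 0, Add 0 7 0]"

section \<open>Effect of the flag-clearing instructions\<close>

lemma dests_clear_adjacent: "\<Union> (dests ` set (clear_adjacent a ps)) \<subseteq> {4, a}"
  by (auto simp: clear_adjacent_def)

lemma dests_clear_equal: "\<Union> (dests ` set (clear_equal a xs)) \<subseteq> {3, 4, a}"
  by (auto simp: clear_equal_def)

text \<open>A flag that has become 0 stays 0 under truncated subtraction. The registers in
  \<open>ps\<close> differ from 4 and \<open>a\<close>, so all addresses can be computed from the
  initial \<open>\<rho>\<close>.\<close>

lemma fold_clear_adjacent:
  assumes "a \<noteq> 4" "\<rho> a \<le> 1" "\<And>r x. (r, x) \<in> set ps \<Longrightarrow> {r, x} \<inter> {4, a} = {}"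
  shows "fold (alu w M) (clear_adjacent a ps) \<rho> a =
    of_bool (\<rho> a = 1 \<and> (\<forall>(r, x)\<in>set ps. M ((\<rho> r + \<rho> x) mod 2 ^ w) = 0))"
  using assms
proof (induction ps arbitrary: \<rho>)
  case Nil
  then show ?case by (auto simp: clear_adjacent_def)
next
  case (Cons p ps)
  obtain r x where p: "p = (r, x)" by fastforce
  let ?\<rho> = "fold (alu w M) [Add 4 r x, Load 4 4, Sub a a 4] \<rho>"
  have new: "?\<rho> a = of_bool (\<rho> a = 1 \<and> M ((\<rho> r + \<rho> x) mod 2 ^ w) = 0)"
    using Cons.prems p by auto
  have ps: "{r', x'} \<inter> {4, a} = {}" if "(r', x') \<in> set ps" for r' x'
    by (rule Cons.prems(3)) (simp add: that)
  then have eq: "(?\<rho> r' + ?\<rho> x') = \<rho> r' + \<rho> x'" if "(r', x') \<in> set ps" for r' x'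
    using ps[OF that] by simp
  have "fold (alu w M) (clear_adjacent a (p # ps)) \<rho> a =
      fold (alu w M) (clear_adjacent a ps) ?\<rho> a"
    by (simp add: clear_adjacent_def p)
  also have "\<dots> = of_bool (?\<rho> a = 1 \<and> (\<forall>(r, x)\<in>set ps. M ((?\<rho> r + ?\<rho> x) mod 2 ^ w) = 0))"
    using Cons.prems new by (intro Cons.IH ps) simp_all
  also have "\<dots> = of_bool (\<rho> a = 1 \<and>
      (\<forall>(r, x)\<in>set (p # ps). M ((\<rho> r + \<rho> x) mod 2 ^ w) = 0))"
  proof -
    have "(\<forall>(r, x)\<in>set ps. M ((?\<rho> r + ?\<rho> x) mod 2 ^ w) = 0) \<longleftrightarrow>
        (\<forall>(r, x)\<in>set ps. M ((\<rho> r + \<rho> x) mod 2 ^ w) = 0)"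
      using eq by (intro ball_cong refl) (simp only: split_paired_all prod.case)
    then show ?thesis
      unfolding new by (simp add: p del: fold.simps)
  qed
  finally show ?case .
qed

lemma fold_clear_equal:
  assumes "a \<notin> {1, 2, 3, 4}" "\<rho> a \<le> 1" "\<rho> 2 = 1" "set xs \<inter> {3, 4, a} = {}"
  shows "fold (alu w M) (clear_equal a xs) \<rho> a =
    of_bool (\<rho> a = 1 \<and> (\<forall>x\<in>set xs. \<rho> x \<noteq> \<rho> 1))"
  using assms
proof (induction xs arbitrary: \<rho>)
  case Nil
  then show ?case by (auto simp: clear_equal_def)
next
  case (Cons x xs)
  let ?\<rho> = "fold (alu w M) [Sub 4 x 1, Sub 4 2 4, Sub 3 1 x, Sub 4 4 3, Sub a a 4] \<rho>"
  have other: "?\<rho> y = \<rho> y" if "y \<notin> {3, 4, a}" for y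
    using that by simp
  have new: "?\<rho> a = of_bool (\<rho> a = 1 \<and> \<rho> x \<noteq> \<rho> 1)"
    using Cons.prems by auto
  have eq: "?\<rho> y = \<rho> y" if "y \<in> set xs" for y
    using Cons.prems(4) that by (intro other) auto
  have "fold (alu w M) (clear_equal a (x # xs)) \<rho> a = fold (alu w M) (clear_equal a xs) ?\<rho> a"
    by (simp add: clear_equal_def)
  also have "\<dots> = of_bool (?\<rho> a = 1 \<and> (\<forall>x\<in>set xs. ?\<rho> x \<noteq> ?\<rho> 1))"
  proof (intro Cons.IH)
    show "?\<rho> 2 = 1" using Cons.prems other[of 2] by simp
    show "?\<rho> a \<le> 1" unfolding new by simp
  qed (use Cons.prems in auto)
  also have "?\<rho> 1 = \<rho> 1"
    using Cons.prems by (intro other) auto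
  also have "of_bool (?\<rho> a = 1 \<and> (\<forall>x\<in>set xs. ?\<rho> x \<noteq> \<rho> 1)) =
      of_bool (\<rho> a = 1 \<and> (\<forall>x\<in>set (x # xs). \<rho> x \<noteq> \<rho> 1))"
    unfolding new using eq by (auto simp del: fold.simps)
  finally show ?case .
qed

section \<open>Registers written by the nested loops, and well-formedness\<close>

lemma writes_vertex_loop: "writes (vertex_loop i c) = {3, idx i, row i} \<union> writes c"
  by (auto simp: vertex_loop_def)

lemma writes_nest: "writes (nest c i) \<subseteq> {3} \<union> idx ` {..<i} \<union> row ` {..<i} \<union> writes c"
  by (induction i) (auto simp: writes_vertex_loop lessThan_Suc)

lemma wf_vertex_loop: "wf_com c \<Longrightarrow> idx i \<notin> writes c \<Longrightarrow> wf_com (vertex_loop i c)"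
  by (auto simp: vertex_loop_def)

lemma writes_check_dominated: "writes (Block (check_dominated m)) \<subseteq> {4, 5, 6}"
  using dests_clear_adjacent[of 6 "map (\<lambda>i. (row i, idx m)) [0..<m]"]
  by (auto simp: check_dominated_def)

lemma writes_check_tuple: "writes (Block (check_tuple m)) \<subseteq> {3, 4, 5}"
  using dests_clear_adjacent[of 5] dests_clear_equal[of 5]
  by (fastforce simp: check_tuple_def)

lemma writes_tuple_test: "writes (tuple_test m) \<subseteq> {3, 4, 5, 6, 7, idx m, row m}"
  using writes_check_tuple[of m] writes_check_dominated[of m]
  by (auto simp: tuple_test_def writes_vertex_loop)

lemma wf_clear_adjacent: "\<forall>i\<in>set (clear_adjacent a ps). dests i \<noteq> {}"
  by (auto simp: clear_adjacent_def)

lemma wf_clear_equal: "\<forall>i\<in>set (clear_equal a xs). dests i \<noteq> {}"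
  by (auto simp: clear_equal_def)

lemma wf_tuple_test: "wf_com (tuple_test m)"
proof -
  have "idx m \<notin> writes (Block (check_dominated m))"
    using writes_check_dominated[of m] by fastforce
  moreover have "wf_com (Block (check_dominated m))" "wf_com (Block (check_tuple m))"
    using wf_clear_adjacent wf_clear_equal
    by (auto simp: check_dominated_def check_tuple_def)
  ultimately show ?thesis
    by (simp add: tuple_test_def wf_vertex_loop del: wf_com.simps(1)) simp
qed

lemma wf_nest_tuple_test: "i \<le> m \<Longrightarrow> wf_com (nest (tuple_test m) i)"
proof (induction i)
  case 0
  then show ?case by (simp add: wf_tuple_test)
next
  case (Suc i)
  have "idx i \<notin> writes (nest (tuple_test m) i)"
    using writes_nest[of "tuple_test m" i] writes_tuple_test[of m] Suc.prems by fastforce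
  with Suc show ?case by (simp add: wf_vertex_loop)
qed

section \<open>Running time\<close>

lemma dur_vertex_loop: "dur n (vertex_loop i c) = 2 + n * (dur n c + 4)"
  by (simp add: vertex_loop_def)

lemma bigo_power_const: "(\<lambda>_. a) \<in> O(\<lambda>n. real n ^ l)" for a :: real
proof (rule bigoI[of _ "\<bar>a\<bar>"])
  show "\<forall>\<^sub>F n in sequentially. norm a \<le> \<bar>a\<bar> * norm (real n ^ l)"
    using eventually_ge_at_top[of 1]
    by eventually_elim (simp add: mult_le_cancel_left1)
qed

lemma dur_vertex_loop_bigo:
  assumes "(\<lambda>n. real (dur n c)) \<in> O(\<lambda>n. real n ^ j)"
  shows "(\<lambda>n. real (dur n (vertex_loop i c))) \<in> O(\<lambda>n. real n ^ Suc j)"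
proof -
  have "(\<lambda>n. real (dur n c) + 4) \<in> O(\<lambda>n. real n ^ j)"
    by (intro sum_in_bigo(1) assms bigo_power_const)
  then have "(\<lambda>n. real n * (real (dur n c) + 4)) \<in> O(\<lambda>n. real n ^ Suc j)"
    unfolding power_Suc by (rule landau_o.big.mult_left)
  then have "(\<lambda>n. 2 + real n * (real (dur n c) + 4)) \<in> O(\<lambda>n. real n ^ Suc j)"
    by (intro sum_in_bigo(1) bigo_power_const)
  then show ?thesis by (simp add: dur_vertex_loop)
qed

lemma dur_nest_bigo:
  assumes "(\<lambda>n. real (dur n c)) \<in> O(\<lambda>n. real n ^ j)"
  shows "(\<lambda>n. real (dur n (nest c i))) \<in> O(\<lambda>n. real n ^ (i + j))"
  using assms by (induction i) (simp_all add: dur_vertex_loop_bigo del: power_Suc)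

text \<open>The instruction lists have lengths depending on \<open>m\<close> alone, so only the
  single loop over candidate neighbours of \<open>v\<close> contributes a factor
  \<open>n\<close>.\<close>

lemma dur_tuple_test_bigo: "(\<lambda>n. real (dur n (tuple_test m))) \<in> O(\<lambda>n. real n ^ 1)"
proof -
  have "(\<lambda>n. real (dur n (Block (check_dominated m)))) \<in> O(\<lambda>n. real n ^ 0)"
    unfolding dur.simps by (rule bigo_power_const)
  from dur_vertex_loop_bigo[OF this, of m] show ?thesis
    unfolding tuple_test_def dur.simps of_nat_add One_nat_def
    by (intro sum_in_bigo(1) bigo_power_const)
qed

text \<open>The \<open>m\<close> nested loops contribute \<open>m\<close> powers of
  \<open>n\<close>, and the linear test one more.\<close>

lemma dur_shedding_com_bigo: "(\<lambda>n. real (dur n (shedding_com m))) \<in> O(\<lambda>n. real n ^ Suc m)"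
  using dur_nest_bigo[OF dur_tuple_test_bigo, of m m]
  unfolding shedding_com_def dur.simps of_nat_add by (intro sum_in_bigo(1) bigo_power_const) simp

section \<open>Correctness of the test\<close>

lemma matrix_cell_less:
  fixes n :: nat
  assumes "x < n" "y < n"
  shows "x * n + y < n * n"
proof -
  have "x * n + y < Suc x * n" using assms by simp
  also have "\<dots> \<le> n * n" using assms by (intro mult_le_mono1) simp
  finally show ?thesis .
qed

text \<open>The bound on \<open>n * n\<close> keeps from wrapping not only the matrix addresses but
  also the row offsets, whose value after the last pass of a loop is \<open>n * n\<close>
  itself.\<close>

locale adjacency_matrix =
  fixes w n v :: nat and M :: "nat \<Rightarrow> nat" and E :: "nat \<Rightarrow> nat \<Rightarrow> bool"
  assumes word: "n * n < 2 ^ w" and v: "v < n"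
    and M: "x < n \<Longrightarrow> y < n \<Longrightarrow> M (x * n + y) = of_bool (E x y)"
begin

text \<open>\<open>J\<close> collects the indices of the loops currently entered, and
  \<open>\<sigma>\<close> gives the vertices they have reached.\<close>

definition env :: "nat set \<Rightarrow> (nat \<Rightarrow> nat) \<Rightarrow> (nat \<Rightarrow> nat) \<Rightarrow> bool" where
  "env J \<sigma> \<rho> \<longleftrightarrow> \<rho> 0 = n \<and> \<rho> 1 = v \<and> \<rho> 2 = 1 \<and>
    (\<forall>j\<in>J. \<sigma> j < n \<and> \<rho> (idx j) = \<sigma> j \<and> \<rho> (row j) = \<sigma> j * n)"

text \<open>A specification in the style of a Hoare triple: the flag survives exactly if it was set
  and \<open>Q\<close> holds. Loops preserve this form, turning \<open>Q\<close> into a universal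
  statement.\<close>

definition clears :: "nat set \<Rightarrow> com \<Rightarrow> nat \<Rightarrow> ((nat \<Rightarrow> nat) \<Rightarrow> bool) \<Rightarrow> bool" where
  "clears J c a Q \<longleftrightarrow>
    (\<forall>\<sigma> \<rho>. env J \<sigma> \<rho> \<longrightarrow> \<rho> a \<le> 1 \<longrightarrow> run w n M c \<rho> a = of_bool (\<rho> a = 1 \<and> Q \<sigma>))"

lemma clearsD:
  "clears J c a Q \<Longrightarrow> env J \<sigma> \<rho> \<Longrightarrow> \<rho> a \<le> 1 \<Longrightarrow> run w n M c \<rho> a = of_bool (\<rho> a = 1 \<and> Q \<sigma>)"
  by (simp add: clears_def)

lemma env_cong:
  "env J \<sigma> \<rho> \<Longrightarrow> (\<And>y. y \<in> {0, 1, 2} \<union> idx ` J \<union> row ` J \<Longrightarrow> \<rho>' y = \<rho> y) \<Longrightarrow> env J \<sigma> \<rho>'"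
  by (simp add: env_def)

lemma n_less: "n < 2 ^ w"
  using word le_square[of n] by (rule le_less_trans[rotated])

lemma word_size_pos: "0 < w"
  using n_less v by (cases w) auto

lemma matrix_entry: "x < n \<Longrightarrow> y < n \<Longrightarrow> M ((x * n + y) mod 2 ^ w) = of_bool (E x y)"
  using word matrix_cell_less[of x n y] by (simp add: M)

text \<open>A flag survives the loop iff it survives every pass, so the loop acts as a bounded
  universal quantifier over the vertex with index \<open>i\<close>.\<close>

lemma clears_vertex_loop:
  assumes c: "clears (insert i J) c a Q"
    and writes: "writes c \<inter> ({0, 1, 2} \<union> idx ` insert i J \<union> row ` insert i J) = {}"
    and "i \<notin> J" "a \<noteq> 3" "a \<notin> {idx i, row i}"
  shows "clears J (vertex_loop i c) a (\<lambda>\<sigma>. \<forall>x<n. Q (\<sigma>(i := x)))"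
  unfolding clears_def
proof (intro allI impI)
  fix \<sigma> \<rho>
  assume \<rho>: "env J \<sigma> \<rho>" "\<rho> a \<le> 1"
  define g where "g = (\<lambda>\<rho>. fold (alu w M) [Add (idx i) (idx i) 2, Sub 3 0 (idx i)]
    (run w n M (Seq c (Block [Add (row i) (row i) 0])) \<rho>))"
  define \<rho>0 where "\<rho>0 = \<rho>(row i := 0, idx i := 0)"
  \<comment> \<open>The invariant treats index \<open>i\<close> separately from \<open>env\<close>,
    because for \<open>j = n\<close> the counter no longer holds a vertex.\<close>
  have loop: "env J \<sigma> ((g ^^ j) \<rho>0) \<and> (g ^^ j) \<rho>0 (idx i) = j \<and> (g ^^ j) \<rho>0 (row i) = j * n \<and>
      (g ^^ j) \<rho>0 a = of_bool (\<rho> a = 1 \<and> (\<forall>x<j. Q (\<sigma>(i := x))))" if "j \<le> n" for j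
    using that
  proof (induction j)
    case 0
    have "env J \<sigma> \<rho>0"
      using \<rho>(1) by (rule env_cong) (use \<open>i \<notin> J\<close> in \<open>auto simp: \<rho>0_def\<close>)
    moreover have "\<rho>0 (idx i) = 0" "\<rho>0 (row i) = 0" "\<rho>0 a = \<rho> a"
      using assms(5) by (simp_all add: \<rho>0_def)
    ultimately show ?case
      using \<rho>(2) by auto
  next
    case (Suc j)
    define \<rho>' where "\<rho>' = (g ^^ j) \<rho>0"
    have IH: "env J \<sigma> \<rho>'" "\<rho>' (idx i) = j" "\<rho>' (row i) = j * n"
      "\<rho>' a = of_bool (\<rho> a = 1 \<and> (\<forall>x<j. Q (\<sigma>(i := x))))"
      using Suc.IH[OF Suc_leD[OF Suc.prems]] unfolding \<rho>'_def by blast+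
    have "env (insert i J) (\<sigma>(i := j)) \<rho>'"
      using IH \<open>i \<notin> J\<close> Suc.prems by (auto simp: env_def)
    from clearsD[OF c this] IH(4)
    have a: "run w n M c \<rho>' a = of_bool (\<rho> a = 1 \<and> (\<forall>x<Suc j. Q (\<sigma>(i := x))))"
      by (auto simp: less_Suc_eq)
    have keep: "run w n M c \<rho>' y = \<rho>' y"
      if "y \<in> {0, 1, 2} \<union> idx ` insert i J \<union> row ` insert i J" for y
      using writes that by (intro run_other) blast
    have "env J \<sigma> (run w n M c \<rho>')"
      using IH(1) by (rule env_cong) (use keep in auto)
    then have "env J \<sigma> (g \<rho>')"
      by (rule env_cong) (use \<open>i \<notin> J\<close> in \<open>auto simp: g_def\<close>)
    \<comment> \<open>This rules out a wrap-around when the row offset is advanced.\<close>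
    moreover have "Suc j * n \<le> n * n"
      using Suc.prems by (intro mult_le_mono1) simp
    then have "g \<rho>' (idx i) = Suc j" "g \<rho>' (row i) = Suc j * n"
      using IH Suc.prems word n_less keep by (auto simp: g_def env_def add.commute)
    moreover have "g \<rho>' a = of_bool (\<rho> a = 1 \<and> (\<forall>x<Suc j. Q (\<sigma>(i := x))))"
      unfolding a[symmetric] using assms(4,5) by (simp add: g_def)
    ultimately show ?case
      unfolding funpow.simps comp_apply \<rho>'_def[symmetric] by blast
  qed
  have "run w n M (vertex_loop i c) \<rho> = (g ^^ n) \<rho>0"
    unfolding vertex_loop_def run.simps(2,3) g_def \<rho>0_def by simp
  then show "run w n M (vertex_loop i c) \<rho> a = of_bool (\<rho> a = 1 \<and> (\<forall>x<n. Q (\<sigma>(i := x))))"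
    using loop[of n] by simp
qed

text \<open>The valuations \<open>\<tau>\<close> vary where the loops inside \<open>nest c i\<close>
  run and agree with \<open>\<sigma>\<close> elsewhere. For \<open>i = m\<close> they range over all
  \<open>m\<close>-tuples of vertices.\<close>

lemma clears_nest:
  assumes c: "clears {..<m} c a Q"
    and writes: "writes c \<inter> ({0, 1, 2} \<union> idx ` {..<m} \<union> row ` {..<m}) = {}"
    and "a < 8" "a \<noteq> 3" "i \<le> m"
  shows "clears {i..<m} (nest c i) a
    (\<lambda>\<sigma>. \<forall>\<tau>. (\<forall>j<i. \<tau> j < n) \<and> (\<forall>j\<ge>i. \<tau> j = \<sigma> j) \<longrightarrow> Q \<tau>)"
  using \<open>i \<le> m\<close>
proof (induction i)
  case 0
  have "(\<forall>j. \<tau> j = \<sigma> j) \<longleftrightarrow> \<tau> = \<sigma>" for \<tau> \<sigma> :: "nat \<Rightarrow> nat"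
    by auto
  then show ?case using c by (simp add: atLeast0LessThan)
next
  case (Suc i)
  let ?Q = "\<lambda>i \<sigma>. \<forall>\<tau>. (\<forall>j<i. \<tau> j < n) \<and> (\<forall>j\<ge>i. \<tau> j = \<sigma> j) \<longrightarrow> Q \<tau>"
  have J: "insert i {Suc i..<m} = {i..<m}"
    using Suc.prems by auto
  have "clears {Suc i..<m} (nest c (Suc i)) a (\<lambda>\<sigma>. \<forall>x<n. ?Q i (\<sigma>(i := x)))"
    unfolding nest.simps
  proof (rule clears_vertex_loop)
    show "clears (insert i {Suc i..<m}) (nest c i) a (?Q i)"
      using Suc unfolding J by simp
    have "writes (nest c i) \<inter> ({0, 1, 2} \<union> idx ` {i..<m} \<union> row ` {i..<m}) = {}"
      using writes writes_nest[of c i] by (fastforce simp: disjoint_iff)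
    then show "writes (nest c i) \<inter>
        ({0, 1, 2} \<union> idx ` insert i {Suc i..<m} \<union> row ` insert i {Suc i..<m}) = {}"
      unfolding J .
  qed (use \<open>a < 8\<close> \<open>a \<noteq> 3\<close> in auto)
  moreover have "(\<forall>x<n. ?Q i (\<sigma>(i := x))) \<longleftrightarrow> ?Q (Suc i) \<sigma>" for \<sigma>
  proof (intro iffI allI impI)
    fix \<tau> assume *: "\<forall>x<n. ?Q i (\<sigma>(i := x))" "(\<forall>j<Suc i. \<tau> j < n) \<and> (\<forall>j\<ge>Suc i. \<tau> j = \<sigma> j)"
    then have "\<forall>j\<ge>i. \<tau> j = (\<sigma>(i := \<tau> i)) j"
      by (auto simp: Suc_le_eq)
    moreover have "\<tau> i < n" "\<forall>j<i. \<tau> j < n"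
      using *(2) by simp_all
    ultimately show "Q \<tau>" using *(1) by blast
  next
    fix x \<tau> assume *: "?Q (Suc i) \<sigma>" "x < n" "(\<forall>j<i. \<tau> j < n) \<and> (\<forall>j\<ge>i. \<tau> j = (\<sigma>(i := x)) j)"
    then have "(\<forall>j<Suc i. \<tau> j < n) \<and> (\<forall>j\<ge>Suc i. \<tau> j = \<sigma> j)"
      by (auto simp: less_Suc_eq)
    with *(1) show "Q \<tau>" by blast
  qed
  ultimately show ?case by simp
qed

text \<open>Entries may repeat, so that an \<open>m\<close>-tuple also represents a nonempty set of
  fewer than \<open>m\<close> vertices; in a loop-free graph, pairs of equal entries never violate
  the condition.\<close>

definition admissible :: "nat \<Rightarrow> (nat \<Rightarrow> nat) \<Rightarrow> bool" where
  "admissible m \<sigma> \<longleftrightarrow> (\<forall>i<m. \<sigma> i \<noteq> v \<and> \<not> E (\<sigma> i) v \<and> (\<forall>j<m. \<not> E (\<sigma> i) (\<sigma> j)))"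

definition dominated :: "nat \<Rightarrow> (nat \<Rightarrow> nat) \<Rightarrow> nat \<Rightarrow> bool" where
  "dominated m \<sigma> u \<longleftrightarrow> (E u v \<longrightarrow> (\<exists>i<m. E (\<sigma> i) u))"

lemma check_tuple_correct:
  assumes "env {..<m} \<sigma> \<rho>"
  shows "fold (alu w M) (check_tuple m) \<rho> 5 = of_bool (admissible m \<sigma>)"
proof -
  let ?ps = "map (\<lambda>i. (row i, 1)) [0..<m] @
      concat (map (\<lambda>i. map (\<lambda>j. (row i, idx j)) [0..<m]) [0..<m])"
  define \<rho>0 where "\<rho>0 = \<rho>(5 := 1 mod 2 ^ w)"
  define \<rho>1 where "\<rho>1 = fold (alu w M) (clear_adjacent 5 ?ps) \<rho>0"
  have "env {..<m} \<sigma> \<rho>0"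
    using assms by (rule env_cong) (auto simp: \<rho>0_def)
  then have e0: "\<rho>0 1 = v" "i < m \<Longrightarrow> \<sigma> i < n" "i < m \<Longrightarrow> \<rho>0 (idx i) = \<sigma> i"
     "i < m \<Longrightarrow> \<rho>0 (row i) = \<sigma> i * n" for i
    by (auto simp: env_def)
  have "env {..<m} \<sigma> \<rho>1"
    using \<open>env {..<m} \<sigma> \<rho>0\<close> unfolding \<rho>1_def
    by (rule env_cong, intro fold_alu_other) (use dests_clear_adjacent[of 5 ?ps] in fastforce)
  then have e1: "\<rho>1 1 = v" "\<rho>1 2 = 1" "i < m \<Longrightarrow> \<rho>1 (idx i) = \<sigma> i" for i
    by (auto simp: env_def)
  have "\<rho>1 5 = of_bool (\<rho>0 5 = 1 \<and> (\<forall>(r, x)\<in>set ?ps. M ((\<rho>0 r + \<rho>0 x) mod 2 ^ w) = 0))"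
    unfolding \<rho>1_def by (rule fold_clear_adjacent) (auto simp: \<rho>0_def word_size_pos)
  also have "(\<forall>(r, x)\<in>set ?ps. M ((\<rho>0 r + \<rho>0 x) mod 2 ^ w) = 0) \<longleftrightarrow>
      (\<forall>i<m. \<not> E (\<sigma> i) v \<and> (\<forall>j<m. \<not> E (\<sigma> i) (\<sigma> j)))"
  proof -
    have "(\<forall>(r, x)\<in>set ?ps. F r x) \<longleftrightarrow>
        (\<forall>i<m. F (row i) 1 \<and> (\<forall>j<m. F (row i) (idx j)))" for F
      by fastforce
    then show ?thesis
      using e0 v by (simp add: matrix_entry)
  qed
  also have "\<rho>0 5 = 1"
    by (simp add: \<rho>0_def word_size_pos)
  finally have \<rho>1: "\<rho>1 5 = of_bool (\<forall>i<m. \<not> E (\<sigma> i) v \<and> (\<forall>j<m. \<not> E (\<sigma> i) (\<sigma> j)))" by simp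
  have "fold (alu w M) (check_tuple m) \<rho> 5 = fold (alu w M) (clear_equal 5 (map idx [0..<m])) \<rho>1 5"
    by (simp add: check_tuple_def \<rho>1_def \<rho>0_def)
  also have "\<dots> = of_bool (\<rho>1 5 = 1 \<and> (\<forall>x\<in>set (map idx [0..<m]). \<rho>1 x \<noteq> \<rho>1 1))"
    using e1 \<rho>1 by (intro fold_clear_equal) auto
  also have "\<dots> = of_bool (admissible m \<sigma>)"
    using \<rho>1 e1 by (auto simp: admissible_def)
  finally show ?thesis .
qed

text \<open>Register 6 starts as the adjacency of the candidate to \<open>v\<close> and is cleared
  by any tuple entry adjacent to the candidate. What remains is the failure of domination, which is
  subtracted from register 5.\<close>

lemma clears_check_dominated:
  "clears (insert m {..<m}) (Block (check_dominated m)) 5 (\<lambda>\<sigma>. dominated m \<sigma> (\<sigma> m))"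
  unfolding clears_def
proof (intro allI impI)
  fix \<sigma> \<rho>
  assume \<rho>: "env (insert m {..<m}) \<sigma> \<rho>" "\<rho> 5 \<le> 1"
  let ?ps = "map (\<lambda>i. (row i, idx m)) [0..<m]"
  define \<rho>0 where "\<rho>0 = fold (alu w M) [Add 4 (row m) 1, Load 6 4] \<rho>"
  have e: "\<rho> 1 = v" "\<sigma> m < n" "\<rho> (row m) = \<sigma> m * n"
    using \<rho> by (auto simp: env_def)
  have "env (insert m {..<m}) \<sigma> \<rho>0"
    using \<rho>(1) by (rule env_cong) (auto simp: \<rho>0_def)
  then have e0: "\<rho>0 (idx m) = \<sigma> m" "i < m \<Longrightarrow> \<sigma> i < n" "i < m \<Longrightarrow> \<rho>0 (row i) = \<sigma> i * n" for i
    by (auto simp: env_def)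
  have \<rho>0: "\<rho>0 5 = \<rho> 5" "\<rho>0 6 = of_bool (E (\<sigma> m) v)"
    using e v by (simp_all add: \<rho>0_def matrix_entry)
  have "fold (alu w M) (clear_adjacent 6 ?ps) \<rho>0 6 =
      of_bool (\<rho>0 6 = 1 \<and> (\<forall>(r, x)\<in>set ?ps. M ((\<rho>0 r + \<rho>0 x) mod 2 ^ w) = 0))"
    by (rule fold_clear_adjacent) (auto simp: \<rho>0)
  also have "\<dots> = of_bool (\<not> dominated m \<sigma> (\<sigma> m))"
    using e e0 \<rho>0 by (auto simp: matrix_entry dominated_def)
  finally have 6: "fold (alu w M) (clear_adjacent 6 ?ps) \<rho>0 6 = of_bool (\<not> dominated m \<sigma> (\<sigma> m))" .
  have 5: "fold (alu w M) (clear_adjacent 6 ?ps) \<rho>0 5 = \<rho> 5"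
    unfolding \<rho>0(1)[symmetric] by (rule fold_alu_other) (use dests_clear_adjacent[of 6 ?ps] in fastforce)
  have "run w n M (Block (check_dominated m)) \<rho> 5 = \<rho> 5 - of_bool (\<not> dominated m \<sigma> (\<sigma> m))"
    using 5 6 by (simp add: check_dominated_def \<rho>0_def)
  then show "run w n M (Block (check_dominated m)) \<rho> 5 =
      of_bool (\<rho> 5 = 1 \<and> dominated m \<sigma> (\<sigma> m))"
    using \<rho>(2) by auto
qed

text \<open>Register 5 is set afresh for each tuple and ends as 1 exactly for a witness against
  shedding; subtracting it from 7 accumulates the answer over all tuples.\<close>

lemma clears_tuple_test:
  "clears {..<m} (tuple_test m) 7 (\<lambda>\<sigma>. \<not> (admissible m \<sigma> \<and> (\<forall>u<n. dominated m \<sigma> u)))"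
  unfolding clears_def
proof (intro allI impI)
  fix \<sigma> \<rho>
  assume \<rho>: "env {..<m} \<sigma> \<rho>" "\<rho> 7 \<le> 1"
  let ?c1 = "Block (check_tuple m)" and ?c2 = "vertex_loop m (Block (check_dominated m))"
  define \<rho>1 where "\<rho>1 = run w n M ?c1 \<rho>"
  have e1: "env {..<m} \<sigma> \<rho>1"
    using \<rho>(1) unfolding \<rho>1_def
    by (rule env_cong, intro run_other) (use writes_check_tuple[of m] in fastforce)
  have \<rho>1: "\<rho>1 5 = of_bool (admissible m \<sigma>)"
    using check_tuple_correct[OF \<rho>(1)] by (simp add: \<rho>1_def)
  have "writes (Block (check_dominated m)) \<inter>
      ({0, 1, 2} \<union> idx ` insert m {..<m} \<union> row ` insert m {..<m}) = {}"
    using writes_check_dominated[of m] by fastforce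
  from clears_vertex_loop[OF clears_check_dominated this]
  have "clears {..<m} ?c2 5 (\<lambda>\<sigma>. \<forall>x<n. dominated m (\<sigma>(m := x)) x)"
    by simp
  from clearsD[OF this e1] \<rho>1 have "run w n M ?c2 \<rho>1 5 =
      of_bool (\<rho>1 5 = 1 \<and> (\<forall>x<n. dominated m (\<sigma>(m := x)) x))"
    by simp
  \<comment> \<open>Domination reads the valuation only below \<open>m\<close>, so the loop variable
    with index \<open>m\<close> drops out.\<close>
  moreover have "dominated m (\<sigma>(m := x)) u \<longleftrightarrow> dominated m \<sigma> u" for x u
    by (auto simp: dominated_def)
  then have "of_bool (\<rho>1 5 = 1 \<and> (\<forall>x<n. dominated m (\<sigma>(m := x)) x)) =
      of_bool (admissible m \<sigma> \<and> (\<forall>x<n. dominated m \<sigma> x))"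
    using \<rho>1 by simp
  ultimately have 5: "run w n M ?c2 \<rho>1 5 = of_bool (admissible m \<sigma> \<and> (\<forall>x<n. dominated m \<sigma> x))"
    by simp
  have "run w n M ?c2 \<rho>1 7 = \<rho>1 7"
    using writes_check_dominated[of m] by (intro run_other) (fastforce simp: writes_vertex_loop)
  also have "\<rho>1 7 = \<rho> 7"
    unfolding \<rho>1_def using writes_check_tuple[of m] by (intro run_other) fastforce
  finally have 7: "run w n M ?c2 \<rho>1 7 = \<rho> 7" .
  have "run w n M (tuple_test m) \<rho> 7 = run w n M ?c2 \<rho>1 7 - run w n M ?c2 \<rho>1 5"
    by (simp add: tuple_test_def \<rho>1_def)
  then show "run w n M (tuple_test m) \<rho> 7 =
      of_bool (\<rho> 7 = 1 \<and> \<not> (admissible m \<sigma> \<and> (\<forall>u<n. dominated m \<sigma> u)))"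
    using \<rho>(2) 5 7 by auto
qed

text \<open>With no loop entered, \<open>env\<close> constrains no value of the valuation. Choosing
  the constant 0 normalises the tuples to 0 from index \<open>m\<close> on.\<close>

lemma shedding_com_correct:
  assumes "env {} (\<lambda>_. 0) \<rho>"
  shows "run w n M (shedding_com m) \<rho> 7 =
    of_bool (\<forall>\<tau>. (\<forall>j<m. \<tau> j < n) \<and> (\<forall>j\<ge>m. \<tau> j = 0) \<longrightarrow>
      \<not> (admissible m \<tau> \<and> (\<forall>u<n. dominated m \<tau> u)))"
proof -
  let ?\<rho> = "\<rho>(7 := 1 mod 2 ^ w)"
  have "env {} (\<lambda>_. 0) ?\<rho>"
    using assms by (rule env_cong) auto
  moreover have "writes (tuple_test m) \<inter> ({0, 1, 2} \<union> idx ` {..<m} \<union> row ` {..<m}) = {}"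
    using writes_tuple_test[of m] by fastforce
  note clears_nest[OF clears_tuple_test this, of m]
  ultimately show ?thesis
    using clearsD[of "{}" "nest (tuple_test m) m" 7 _ "\<lambda>_. 0" ?\<rho>]
    by (simp add: shedding_com_def word_size_pos)
qed

text \<open>The three extra steps are the initialisation of register 2 and the two instructions that
  copy the answer from register 7 to register 0.\<close>

lemma shedding_program_correct:
  assumes "\<rho> 0 = n" "\<rho> 1 = v"
  shows "decides_within w (shedding_program m) (cfg M 0 \<rho>) (dur n (shedding_com m) + 3)
    (\<forall>\<tau>. (\<forall>j<m. \<tau> j < n) \<and> (\<forall>j\<ge>m. \<tau> j = 0) \<longrightarrow>
      \<not> (admissible m \<tau> \<and> (\<forall>u<n. dominated m \<tau> u)))"
    (is "decides_within _ ?P _ _ ?b")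
proof -
  let ?c = "shedding_com m"
  let ?code = "compile 1 ?c"
  define \<rho>1 where "\<rho>1 = \<rho>(2 := 1 mod 2 ^ w)"
  define \<rho>2 where "\<rho>2 = run w n M ?c \<rho>1"
  have P: "?P = [Const 2 1] @ ?code @ [Const 0 0, Add 0 7 0]"
    by (simp add: shedding_program_def)
  have \<rho>1: "\<rho>1 0 = n" "\<rho>1 1 = v" "\<rho>1 2 = 1"
    using assms by (simp_all add: \<rho>1_def word_size_pos)
  have "writes ?c \<inter> {0, 2} = {}"
    using writes_nest[of "tuple_test m" m] writes_tuple_test[of m]
    by (fastforce simp: shedding_com_def)
  then have "(step w ?P ^^ dur n ?c) (cfg M 1 \<rho>1) = cfg M (1 + length ?code) \<rho>2"
    unfolding \<rho>2_def using \<rho>1 n_less v P wf_nest_tuple_test[of m m]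
      compile_correct[of ?c \<rho>1 n w ?P "[Const 2 1]" "[Const 0 0, Add 0 7 0]" M]
    by (simp add: shedding_com_def)
  moreover have "(step w ?P ^^ 1) (cfg M 0 \<rho>) = cfg M 1 \<rho>1"
    using step_at[of ?P "[]" "Const 2 1"] P by (simp add: \<rho>1_def)
  moreover have "\<rho>2 7 = of_bool ?b"
    unfolding \<rho>2_def using \<rho>1 by (intro shedding_com_correct) (simp add: env_def)
  then have "(step w ?P ^^ 2) (cfg M (1 + length ?code) \<rho>2) =
      cfg M (length ?P) (\<rho>2(0 := of_bool ?b))"
    using steps_block[of "[Const 0 0, Add 0 7 0]" ?P "[Const 2 1] @ ?code" "[]" w] P n_less v
    by (simp add: numeral_2_eq_2)
  ultimately have "(step w ?P ^^ (1 + dur n ?c + 2)) (cfg M 0 \<rho>) =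
      cfg M (length ?P) (\<rho>2(0 := of_bool ?b))"
    by (intro funpow_trans)
  then show ?thesis
    unfolding decides_within_def by (intro exI[of _ "1 + dur n ?c + 2"]) (simp add: halted_def)
qed

end

section \<open>Witnesses against shedding as tuples\<close>

text \<open>Both bounds need the maximum to be over a finite nonempty set: sizes are those of
  subsets of \<open>pverts G\<close>, and the empty set is independent.\<close>

lemma (in pair_graph)
  shows independent_set_card_le: "independent_set G S \<Longrightarrow> card S \<le> independence_number G"
    and independence_number_le: "independence_number G \<le> card (pverts G)"
proof -
  let ?A = "{card S | S. independent_set G S}"
  have "?A \<subseteq> card ` Pow (pverts G)"
    by (auto simp: independent_set_def)
  then have fin: "finite ?A"
    by (rule finite_subset) simp
  then show "independent_set G S \<Longrightarrow> card S \<le> independence_number G"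
    unfolding independence_number_def by (intro Max_ge) auto
  have "independent_set G {}"
    by (simp add: independent_set_def)
  then have "?A \<noteq> {}"
    by blast
  with fin show "independence_number G \<le> card (pverts G)"
    unfolding independence_number_def by (auto simp: independent_set_def intro!: card_mono)
qed

lemma ex_tuple_image:
  fixes S :: "nat set"
  assumes "finite S" "S \<noteq> {}" "card S \<le> m"
  shows "\<exists>\<tau>. \<tau> ` {..<m} = S \<and> (\<forall>j\<ge>m. \<tau> j = 0)"
proof -
  obtain h where h: "bij_betw h {0..<card S} S"
    using assms(1) ex_bij_betw_nat_finite by blast
  have S: "S = h ` {..<card S}"
    using h by (simp add: bij_betw_def atLeast0LessThan)
  have "card S > 0"
    using assms by (simp add: card_gt_0_iff)
  \<comment> \<open>The element \<open>h 0\<close>, available since \<open>S\<close> is nonempty,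
    pads the enumeration to length \<open>m\<close>; the value 0 beyond matches the tuples that the
    program runs through.\<close>
  define \<tau> where "\<tau> = (\<lambda>j. if j < card S then h j else if j < m then h 0 else 0)"
  have "\<tau> ` {..<m} \<subseteq> S"
    using \<open>card S > 0\<close> by (subst S) (auto simp: \<tau>_def)
  moreover have "h j \<in> \<tau> ` {..<m}" if "j < card S" for j
    using that assms(3) by (intro image_eqI[of _ _ j]) (auto simp: \<tau>_def)
  then have "S \<subseteq> \<tau> ` {..<m}"
    by (subst S) auto
  ultimately show ?thesis
    using assms(3) by (intro exI[of _ \<tau>]) (auto simp: \<tau>_def)
qed

lemma (in adjacency_matrix) shedding_vertex_iff:
  assumes "pair_graph G" "pverts G = {..<n}" "independence_number G = Suc m" "m \<ge> 1"
    and E: "\<And>x y. E x y \<longleftrightarrow> (x, y) \<in> parcs G"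
  shows "shedding_vertex G v \<longleftrightarrow> (\<forall>\<tau>. (\<forall>j<m. \<tau> j < n) \<and> (\<forall>j\<ge>m. \<tau> j = 0) \<longrightarrow>
    \<not> (admissible m \<tau> \<and> (\<forall>u<n. dominated m \<tau> u)))" (is "_ \<longleftrightarrow> ?tuples")
proof -
  interpret G: pair_graph G by fact
  have sym: "E x y \<longleftrightarrow> E y x" and irrefl: "\<not> E x x" for x y
    using G.arcs_symmetric G.no_loops' by (auto simp: E)
  \<comment> \<open>The program reads column \<open>v\<close>, whereas \<open>neighbourhood\<close>
    uses the arcs leaving \<open>v\<close>; symmetry identifies the two.\<close>
  have nbh: "neighbourhood G v = {u. u < n \<and> E u v}"
    using sym by (auto simp: neighbourhood_def assms(2) E)
  have indep: "independent_set G S \<longleftrightarrow> S \<subseteq> {..<n} \<and> (\<forall>x\<in>S. \<forall>y\<in>S. \<not> E x y)" for S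
    by (simp add: independent_set_def assms(2) E)
  let ?outside = "\<lambda>S. S \<subseteq> pverts G - closed_neighbourhood G v \<and> independent_set G S"
  have outside: "?outside S \<longleftrightarrow>
      (\<forall>x\<in>S. x < n \<and> x \<noteq> v \<and> \<not> E x v) \<and> (\<forall>x\<in>S. \<forall>y\<in>S. \<not> E x y)" for S
    by (auto simp: closed_neighbourhood_def nbh indep assms(2))
  have shedding: "shedding_vertex G v \<longleftrightarrow>
      (\<forall>S. ?outside S \<longrightarrow> (\<exists>u<n. E u v \<and> (\<forall>s\<in>S. \<not> E s u)))"
  proof -
    have "(\<exists>u\<in>neighbourhood G v. independent_set G (S \<union> {u})) \<longleftrightarrow>
        (\<exists>u<n. E u v \<and> (\<forall>s\<in>S. \<not> E s u))" if "?outside S" for S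
    proof -
      \<comment> \<open>\<open>S\<close> is already independent and there are no loops, so only
        pairs between \<open>u\<close> and \<open>S\<close> can fail.\<close>
      have "independent_set G (S \<union> {u}) \<longleftrightarrow> (\<forall>s\<in>S. \<not> E s u)" if "u < n" for u
        using \<open>?outside S\<close> that sym[of u] irrefl by (auto simp: indep)
      then show ?thesis by (auto simp: nbh)
    qed
    then show ?thesis unfolding shedding_vertex_def by blast
  qed
  show ?thesis
  proof
    assume "shedding_vertex G v"
    show ?tuples
    proof (intro allI impI notI)
      fix \<tau>
      assume \<tau>: "(\<forall>j<m. \<tau> j < n) \<and> (\<forall>j\<ge>m. \<tau> j = 0)"
        and bad: "admissible m \<tau> \<and> (\<forall>u<n. dominated m \<tau> u)"
      then have out: "?outside (\<tau> ` {..<m})"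
        unfolding outside by (auto simp: admissible_def)
      have "\<exists>u<n. E u v \<and> (\<forall>s\<in>\<tau> ` {..<m}. \<not> E s u)"
        using \<open>shedding_vertex G v\<close> out unfolding shedding by (elim allE impE)
      then obtain u where "u < n" "E u v" "\<forall>s\<in>\<tau> ` {..<m}. \<not> E s u"
        by blast
      with bad show False
        by (auto simp: dominated_def)
    qed
  next
    assume tuples: ?tuples
    show "shedding_vertex G v"
      unfolding shedding
    proof (intro allI impI, rule ccontr)
      fix S
      assume S: "?outside S" "\<not> (\<exists>u<n. E u v \<and> (\<forall>s\<in>S. \<not> E s u))"
      obtain S' where S': "?outside S'" "S' \<noteq> {}" "\<not> (\<exists>u<n. E u v \<and> (\<forall>s\<in>S'. \<not> E s u))"
      proof (cases "S = {}")
        case True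
        \<comment> \<open>The independence number is \<open>Suc m\<close> with
          \<open>m \<ge> 1\<close>, which forces a vertex other than \<open>v\<close>.\<close>
        have "2 \<le> n"
          using G.independence_number_le assms by simp
        then have "\<exists>x<n. x \<noteq> v"
          by (intro exI[of _ "if v = 0 then 1 else 0"]) auto
        then obtain x where x: "x < n" "x \<noteq> v"
          by blast
        have isolated: "\<not> E u v" if "u < n" for u
          using S(2) True that by simp
        show ?thesis
        proof (rule that)
          show "?outside {x}"
            using x isolated irrefl by (simp only: outside) simp
          show "\<not> (\<exists>u<n. E u v \<and> (\<forall>s\<in>{x}. \<not> E s u))"
            using isolated by blast
        qed simp
      next
        case False
        show ?thesis by (rule that[OF S(1) False S(2)])
      qed
      have "finite S'"
        using S'(1) by (auto simp: assms(2) intro: finite_subset)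
      have "independent_set G (insert v S')"
        using S'(1) v sym irrefl unfolding outside by (auto simp: indep)
      from G.independent_set_card_le[OF this] have "card S' \<le> m"
        using \<open>finite S'\<close> S'(1) assms(3) unfolding outside by (subst (asm) card_insert_disjoint) auto
      with \<open>finite S'\<close> S'(2) obtain \<tau> where \<tau>: "\<tau> ` {..<m} = S'" "\<forall>j\<ge>m. \<tau> j = 0"
        using ex_tuple_image by blast
      have in_S': "\<tau> j \<in> S'" if "j < m" for j
        using \<tau>(1) that by blast
      have "admissible m \<tau>" "\<forall>j<m. \<tau> j < n"
        using S'(1) in_S' unfolding outside admissible_def by simp_all
      moreover have "dominated m \<tau> u" if "u < n" for u
        using S'(3) that \<tau>(1) unfolding dominated_def by blast
      ultimately show False
        using tuples \<tau>(2) by blast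
    qed
  qed
qed

section \<open>The decision procedure for fixed independence number\<close>

theorem theorem8p2:
  fixes k :: nat
  assumes "k \<ge> 2"
  shows "\<exists>(P :: program) (c :: nat) (T :: nat \<Rightarrow> nat).
    c \<ge> 1 \<and>
    (\<lambda>n. real (T n)) \<in> O(\<lambda>n. real n ^ k) \<and>
    (\<forall>(n :: nat) (G :: nat pair_pre_digraph) (v :: nat).
      pair_graph G \<and> pverts G = {..<n} \<and> independence_number G = k \<and> v \<in> pverts G \<longrightarrow>
      decides_within (word_size c n) P (input_config n G v) (T n) (shedding_vertex G v))"
proof -
  obtain m where m: "k = Suc m" "m \<ge> 1"
    using assms by (cases k) auto
  define T where "T = (\<lambda>n. dur n (shedding_com m) + 3)"
  have "decides_within (word_size 2 n) (shedding_program m) (input_config n G v) (T n)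
      (shedding_vertex G v)"
    if G: "pair_graph G" "pverts G = {..<n}" "independence_number G = k" and "v \<in> pverts G"
    for n v :: nat and G :: "nat pair_pre_digraph"
  proof -
    have "v < n" using G(2) \<open>v \<in> pverts G\<close> by simp
    \<comment> \<open>Doubling the bit length of \<open>n\<close> makes words long enough for matrix
      addresses, whence the word size constant 2.\<close>
    have "n < 2 ^ floorlog 2 n"
      using floorlog_bounds[of n 2] \<open>v < n\<close> by simp
    then have "n * n < 2 ^ floorlog 2 n * 2 ^ floorlog 2 n"
      by (intro mult_strict_mono) simp_all
    also have "\<dots> = 2 ^ word_size 2 n"
      by (simp add: word_size_def mult_2 power_add)
    finally have word: "n * n < 2 ^ word_size 2 n" .
    interpret adjacency_matrix "word_size 2 n" n v "mem (input_config n G v)"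
      "\<lambda>x y. (x, y) \<in> parcs G"
    proof unfold_locales
      fix x y assume "x < n" "y < n"
      then have "(x * n + y) div n = x" "(x * n + y) mod n = y" "x * n + y < n * n"
        using matrix_cell_less by simp_all
      then show "mem (input_config n G v) (x * n + y) = of_bool ((x, y) \<in> parcs G)"
        by (simp add: input_config_def)
    qed (use word \<open>v < n\<close> in simp_all)
    have "input_config n G v = cfg (mem (input_config n G v)) 0 (reg (input_config n G v))"
      by (simp add: input_config_def)
    then show ?thesis
      using shedding_program_correct[of "reg (input_config n G v)" m]
        shedding_vertex_iff[of G m] G m
      by (simp add: T_def input_config_def)
  qed
  moreover have "(\<lambda>n. real (T n)) \<in> O(\<lambda>n. real n ^ k)"
    unfolding T_def m(1) of_nat_add by (intro sum_in_bigo(1) dur_shedding_com_bigo bigo_power_const)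
  ultimately show ?thesis
    by (intro exI[of _ "shedding_program m"] exI[of _ 2] exI[of _ T]) auto
qed

end
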